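(* Let $\lambda\in\mathbb{C}$ and let $\mathcal{H}_0$ be the complex vector space with basis $e_1,e_2,e_3$. Define two bilinear operations $\prec,\succ$ on $\mathcal{H}_0$ by $$e_1\prec e_3=(1-\lambda)e_2,\qquad e_1\succ e_3=\lambda e_2,$$ all other products of basis vectors being zero. Then $(\mathcal{H}_0,\succ,\prec)$ is a dendriform algebra.
   Context: A dendriform algebra is a vector space $\mathcal{A}$ with two bilinear products $\prec,\succ$ such that, with $x\ast y=x\prec y+x\succ y$, for all $x,y,z\in\mathcal{A}$: $(x\prec y)\prec z=x\prec(y\ast z)$, $(x\succ y)\prec z=x\succ(y\prec z)$, $x\succ(y\succ z)=(x\ast y)\succ z$. (In the paper $\mathcal{H}_0$ carries the associative product whose only nonzero product of basis vectors is $e_1\cdot e_3=e_2$.) *)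

theory Defs
  imports Complex_Main
begin

locale dendriform_algebra = vector_space scale
  for scale :: "'k::field \<Rightarrow> 'a::ab_group_add \<Rightarrow> 'a" +
  fixes succ :: "'a \<Rightarrow> 'a \<Rightarrow> 'a" (infixl \<open>\<succ>\<close> 70)
    and prec :: "'a \<Rightarrow> 'a \<Rightarrow> 'a" (infixl \<open>\<prec>\<close> 70)
  assumes linear_succ_left: "Vector_Spaces.linear scale scale (\<lambda>x. x \<succ> y)"
    and linear_succ_right: "Vector_Spaces.linear scale scale (\<lambda>y. x \<succ> y)"
    and linear_prec_left: "Vector_Spaces.linear scale scale (\<lambda>x. x \<prec> y)"
    and linear_prec_right: "Vector_Spaces.linear scale scale (\<lambda>y. x \<prec> y)"
    and prec_prec: "(x \<prec> y) \<prec> z = x \<prec> (y \<prec> z + y \<succ> z)"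
    and succ_prec: "(x \<succ> y) \<prec> z = x \<succ> (y \<prec> z)"
    and succ_succ: "x \<succ> (y \<succ> z) = (x \<prec> y + x \<succ> y) \<succ> z"

text \<open>
  The bilinear operation with prescribed values \<open>t a b\<close> on the pairs of vectors of a finite
  basis \<open>B\<close>. The lemmas below show that it is the unique such operation.
\<close>

definition bilinear_extension ::
    "('k::field \<Rightarrow> 'a::ab_group_add \<Rightarrow> 'a) \<Rightarrow> 'a set \<Rightarrow> ('a \<Rightarrow> 'a \<Rightarrow> 'a) \<Rightarrow> 'a \<Rightarrow> 'a \<Rightarrow> 'a" where
  "bilinear_extension scale B t x y =
     (\<Sum>a\<in>B. \<Sum>b\<in>B.
        scale (module.representation scale B x a * module.representation scale B y b) (t a b))"

lemma bilinear_extension_basis: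
  assumes "vector_space scale" "finite B" "\<not> module.dependent scale B" "a \<in> B" "b \<in> B"
  shows "bilinear_extension scale B t a b = t a b"
proof -
  interpret vector_space scale by fact
  have "bilinear_extension scale B t a b =
      (\<Sum>a'\<in>B. \<Sum>b'\<in>B. if b' = b then (if a' = a then t a b else 0) else 0)"
    unfolding bilinear_extension_def
    by (intro sum.cong refl) (auto simp: representation_basis assms)
  then show ?thesis
    using assms by (simp add: sum.delta)
qed

lemma linear_bilinear_extension:
  assumes "vector_space scale" "\<not> module.dependent scale B" "module.span scale B = UNIV"
  shows "Vector_Spaces.linear scale scale (\<lambda>x. bilinear_extension scale B t x y)"
    and "Vector_Spaces.linear scale scale (\<lambda>y. bilinear_extension scale B t x y)"
proof -
  interpret vector_space scale by fact
  interpret vector_space_pair scale scale ..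
  show "Vector_Spaces.linear scale scale (\<lambda>x. bilinear_extension scale B t x y)"
    "Vector_Spaces.linear scale scale (\<lambda>y. bilinear_extension scale B t x y)"
    using assms(2,3)
    by (simp_all add: Vector_Spaces.linear_iff vector_space_axioms bilinear_extension_def representation_add representation_scale
        algebra_simps sum.distrib scale_sum_right)
qed

lemma bilinear_extension_unique:
  assumes "vector_space scale" "finite B" "\<not> module.dependent scale B"
    and "module.span scale B = UNIV"
    and l: "\<And>y. Vector_Spaces.linear scale scale (\<lambda>x. f x y)"
    and r: "\<And>x. Vector_Spaces.linear scale scale (\<lambda>y. f x y)"
    and t: "\<And>a b. a \<in> B \<Longrightarrow> b \<in> B \<Longrightarrow> f a b = t a b"
  shows "f = bilinear_extension scale B t"
proof (intro ext)
  fix x y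
  interpret vector_space scale by fact
  interpret vector_space_pair scale scale ..
  note lin = linear_bilinear_extension[OF assms(1,3,4)]
  have "f a y = bilinear_extension scale B t a y" if "a \<in> B" for a
    using linear_eq_on_span[OF r[of a] lin(2)[of t a], of B y] that t assms(1-4)
    by (simp add: bilinear_extension_basis)
  then show "f x y = bilinear_extension scale B t x y"
    using linear_eq_on_span[OF l[of y] lin(1)[of t y], of B x] assms(4) by simp
qed

end

(*
  Both operations send (x, y) to a constant times (the e1-coordinate of x) times
  (the e3-coordinate of y) times e2. The e1- and e3-coordinates of e2 are 0, so every product
  of three vectors vanishes, and the dendriform identities read 0 = 0.
*)

theory Submission
  imports Defs
begin

text \<open>Only the pair \<open>(p, q)\<close> contributes to the double sum. This gives both
  operations a closed form in terms of two coordinates.\<close>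

lemma bilinear_extension_single:
  assumes "vector_space scale" "finite B" "p \<in> B" "q \<in> B"
  shows "bilinear_extension scale B (\<lambda>a b. if a = p \<and> b = q then v else 0) x y =
    scale (module.representation scale B x p * module.representation scale B y q) v"
proof -
  interpret vector_space scale by fact
  \<comment> \<open>Nesting the two tests lets \<open>sum.delta\<close> collapse the inner sum, then
    the outer one.\<close>
  have "bilinear_extension scale B (\<lambda>a b. if a = p \<and> b = q then v else 0) x y =
      (\<Sum>a\<in>B. \<Sum>b\<in>B. if b = q then
        (if a = p then scale (representation B x p * representation B y q) v else 0) else 0)"
    unfolding bilinear_extension_def by (intro sum.cong refl) auto
  then show ?thesis
    using assms by (simp add: sum.delta)
qed

theorem proposition4p1:
  fixes scale :: "complex \<Rightarrow> 'a::ab_group_add \<Rightarrow> 'a"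
    and e1 e2 e3 :: 'a
    and lam :: complex
  assumes "vector_space scale"
    and "distinct [e1, e2, e3]"
    and "\<not> module.dependent scale {e1, e2, e3}"
    and "module.span scale {e1, e2, e3} = UNIV"
  shows "dendriform_algebra scale
    (bilinear_extension scale {e1, e2, e3}
      (\<lambda>a b. if a = e1 \<and> b = e3 then scale lam e2 else 0))
    (bilinear_extension scale {e1, e2, e3}
      (\<lambda>a b. if a = e1 \<and> b = e3 then scale (1 - lam) e2 else 0))"
proof -
  interpret vector_space scale by fact
  let ?B = "{e1, e2, e3}"
  \<comment> \<open>One family covers both operations: \<open>c = lam\<close> gives \<succ> and
    \<open>c = 1 - lam\<close> gives \<prec>.\<close>
  let ?f = "\<lambda>c. bilinear_extension scale ?B (\<lambda>a b. if a = e1 \<and> b = e3 then scale c e2 else 0)"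
  have f: "?f c x y = scale (representation ?B x e1 * representation ?B y e3 * c) e2" for c x y
    by (simp add: bilinear_extension_single[OF assms(1)])
  have "e1 \<noteq> e2" "e3 \<noteq> e2"
    using assms(2) by auto
  then have rep_e2: "representation ?B (scale d e2) e1 = 0" "representation ?B (scale d e2) e3 = 0" for d
    by (simp_all add: representation_scale[OF assms(3)] representation_basis[OF assms(3)] assms(4))
  \<comment> \<open>By \<open>f\<close> the inner product is a multiple of \<open>e2\<close>. Since
    \<open>c\<close> and \<open>d\<close> are independent, products mixing \<prec> and \<succ> are
    included.\<close>
  have left: "?f c (?f d x y) z = 0" and right: "?f c x (?f d y z) = 0" for c d x y z
    by (simp_all only: f rep_e2 mult_zero_left mult_zero_right scale_zero_left)
  note lin = linear_bilinear_extension[OF assms(1,3,4)]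
  \<comment> \<open>Additivity splits the sum of \<prec> and \<succ> inside two of the axioms into
    triple products, to which \<open>left\<close> and \<open>right\<close> apply.\<close>
  have add_left: "?f c (x + y) z = ?f c x z + ?f c y z" for c x y z
    using lin(1)[unfolded Vector_Spaces.linear_iff] by blast
  have add_right: "?f c x (y + z) = ?f c x y + ?f c x z" for c x y z
    using lin(2)[unfolded Vector_Spaces.linear_iff] by blast
  show ?thesis
    by (intro dendriform_algebra.intro dendriform_algebra_axioms.intro assms(1) lin)
      (simp_all only: add_left add_right left right add_0_left)
qed

end
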